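(* Let $G$ be an $n$-vertex graph of maximum degree $\Delta$ such that, for every vertex $u\in V(G)$, the subgraph $G[N(u)]$ induced by the neighbourhood of $u$ has average degree at most $d$, where $d \le \frac{\Delta}{6}-1$. Let $\rho \coloneqq \Delta/(d+1)$. For each vertex $v\in V(G)$ let $q(v)$ be a number with \[q(v) \ge \left(1+\frac{1}{\ln \rho}\right) \frac{\deg(v)}{W\left(\frac{\deg(v)}{(d+1)(\ln \rho)^3}\right)},\] and suppose $L\colon V(G)\to 2^{\mathbb{N}}$ is a list assignment with $|L(v)| \ge \left(1+\frac{1}{\ln \rho}\right) q(v)$ for every vertex $v\in V(G)$. Then there are at least $\left(q/\sqrt{D}\right)^n$ proper $L$-colourings of $G$, where $D$ is the geometric mean of the degrees $\{\deg(v)\}_{v\in V(G)}$ and $q$ is the geometric mean of $\{q(v)\}_{v\in V(G)}$.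
   Context: $W$ denotes the Lambert $W$-function, i.e. the inverse of the function $z \mapsto z e^z$ on $[0,\infty)$. A list assignment of $G$ is a map $L\colon V(G)\to 2^{\mathbb{N}}$; a proper $L$-colouring is a map $c\colon V(G)\to\mathbb{N}$ with $c(v)\in L(v)$ for every vertex $v$ and $c(u)\neq c(v)$ for every edge $uv$. *)

theory Defs
  imports Complex_Main "HOL-Library.FuncSet" "Graph_Theory.Digraph_Component"
begin

text \<open>
  A finite simple graph is a structure satisfying the locale predicate \<open>graph\<close> of
  \<open>Graph_Theory.Digraph\<close>: finite, loop-free, without parallel arcs, and symmetric. Each
  undirected edge is a pair of opposite arcs, so the degree of a vertex is its \<open>out_degree\<close>
  and twice the number of edges is the sum of the out-degrees.
\<close>

definition neighbourhood :: "('a, 'b) pre_digraph \<Rightarrow> 'a \<Rightarrow> 'a set" where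
  "neighbourhood G u = {v. u \<rightarrow>\<^bsub>G\<^esub> v}"

definition max_degree :: "('a, 'b) pre_digraph \<Rightarrow> nat" where
  "max_degree G = Max (out_degree G ` verts G)"

text \<open>The graph without vertices has average degree \<open>0 / 0 = 0\<close>.\<close>

definition average_degree :: "('a, 'b) pre_digraph \<Rightarrow> real" where
  "average_degree G = (\<Sum>v\<in>verts G. real (out_degree G v)) / real (card (verts G))"

text \<open>Meaningful for nonnegative arguments only.\<close>

definition lambert_W :: "real \<Rightarrow> real" where
  "lambert_W = the_inv_into {0..} (\<lambda>z. z * exp z)"

definition geometric_mean :: "'a set \<Rightarrow> ('a \<Rightarrow> real) \<Rightarrow> real" where
  "geometric_mean A f = root (card A) (\<Prod>x\<in>A. f x)"

text \<open>Extensional functions are used so that colourings differing only outside the vertex set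
  are not counted separately.\<close>

definition proper_list_colourings ::
    "('a, 'b) pre_digraph \<Rightarrow> ('a \<Rightarrow> nat set) \<Rightarrow> ('a \<Rightarrow> nat) set" where
  "proper_list_colourings G L =
     {c \<in> (\<Pi>\<^sub>E v\<in>verts G. L v). \<forall>u v. u \<rightarrow>\<^bsub>G\<^esub> v \<longrightarrow> c u \<noteq> c v}"

text \<open>The lower bound \<open>x \<le> |A|\<close> on a cardinality, for a possibly infinite set \<open>A\<close>
  (where \<open>card A = 0\<close>): lists, and hence the set of colourings, may be infinite.\<close>

definition card_at_least :: "'a set \<Rightarrow> real \<Rightarrow> bool" where
  "card_at_least A x \<longleftrightarrow> infinite A \<or> x \<le> real (card A)"

end

theory Submission
  imports Defs
begin

text \<open>
  Write \<open>l = ln \<rho>\<close>, \<open>s = (d + 1) l\<close>, \<open>w(v)\<close> for the value of \<open>W\<close> at \<open>v\<close>, and \<open>C(S)\<close> for the number of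
  colourings of the subgraph induced by \<open>S\<close>. By the choice of \<open>q\<close>, the quantity \<open>q(v) exp(-w(v))\<close>
  is at least \<open>A = (1 + 1/l) (d + 1) l\<^sup>3\<close> for every vertex \<open>v\<close>, whatever its degree. A Rosenfeld-type
  induction proves \<open>C(S) \<ge> A C(S - v)\<close>: take a uniform colouring of \<open>S - v\<close>, and call a neighbour \<open>u\<close>
  of \<open>v\<close> starved if fewer than \<open>1 + s + d\<^sub>u\<close> colours are available to it from outside \<open>N(v)\<close>, where
  \<open>d\<^sub>u\<close> is its degree inside \<open>N(v)\<close>. By the induction hypothesis \<open>u\<close> is starved with probability at
  most \<open>(1 + s + d\<^sub>u) / A\<close>, so on average the starved neighbours cost at most \<open>deg(v) / l\<^sup>2 \<le> q(v) / l\<close>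
  colours, which is the surplus of \<open>L(v)\<close> over \<open>q(v)\<close>. Recolouring the other neighbours one at a time
  shows that a colour survives with probability at least \<open>exp(-z)\<close>, where the exponents \<open>z\<close> sum up
  over all colours to at most \<open>\<Sum>\<^sub>u (1 + (1 + d\<^sub>u) / s)\<close>.

  The exponent at \<open>v\<close> counts only the edges and triangles still present when \<open>v\<close> is removed. If vertices
  are removed in decreasing order of \<open>q\<close>, each edge and triangle is charged to its endpoint with the
  smallest \<open>1 / q\<close>; in total this halves the exponents to \<open>w(v) / 2 \<le> ln (deg v) / 2\<close>, which yields
  the factor \<open>1 / \<surd>D\<close>. Vertices of degree 1, where \<open>w(v) \<le> ln (deg v)\<close> fails, are removed first and
  lose at most one colour.
\<close>

section \<open>Recolouring\<close>

text \<open>Turns a survival factor 1 - 1/x into an exponential, so that the losses caused by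
  several neighbours add up.\<close>

lemma one_minus_inverse_ge_exp:
  fixes x :: real assumes "x > 1"
  shows "exp (- 1 / (x - 1)) \<le> 1 - 1 / x"
proof -
  have "x / (x - 1) = 1 + 1 / (x - 1)" using assms by (simp add: field_simps)
  also have "\<dots> \<le> exp (1 / (x - 1))" by (rule exp_ge_add_one_self)
  finally have "inverse (exp (1 / (x - 1))) \<le> inverse (x / (x - 1))"
    using assms by (intro le_imp_inverse_le) auto
  moreover have "inverse (x / (x - 1)) = 1 - 1 / x" using assms by (simp add: field_simps)
  ultimately show ?thesis by (simp add: exp_minus)
qed

text \<open>In the application \<open>\<Omega>\<close> is a fibre of colourings that agree outside
  \<open>N\<close>; \<open>M u\<close> holds the colours which this common part leaves to
  \<open>u\<close>, and \<open>nb u\<close> the neighbours of \<open>u\<close> inside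
  \<open>N\<close>.\<close>

locale recolouring =
  fixes \<Omega> :: "('a \<Rightarrow> 'c) set" and N :: "'a set" and M :: "'a \<Rightarrow> 'c set"
    and nb :: "'a \<Rightarrow> 'a set" and s :: real
  assumes finite_\<Omega>: "finite \<Omega>" and finite_N: "finite N" and s_pos: "s > 0"
    and finite_M: "u \<in> N \<Longrightarrow> finite (M u)"
    and finite_nb: "u \<in> N \<Longrightarrow> finite (nb u)"
    and colour_mem: "\<sigma> \<in> \<Omega> \<Longrightarrow> u \<in> N \<Longrightarrow> \<sigma> u \<in> M u"
    and recolour: "\<sigma> \<in> \<Omega> \<Longrightarrow> u \<in> N \<Longrightarrow> c \<in> M u \<Longrightarrow> c \<notin> \<sigma> ` nb u \<Longrightarrow> \<sigma>(u := c) \<in> \<Omega>"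
    and card_M: "u \<in> N \<Longrightarrow> real (card (M u)) \<ge> real (card (nb u)) + 1 + s"
begin

text \<open>With x = |M u| - |nb u|, a lower bound for the colours open to \<open>u\<close>, this is
  the exponent 1/(x - 1) that bounds 1 - 1/x from below.\<close>

definition loss :: "'c \<Rightarrow> 'a \<Rightarrow> real" where
  "loss c u = (if c \<in> M u then 1 / (real (card (M u)) - real (card (nb u)) - 1) else 0)"

text \<open>Double counting: a colouring that uses \<open>c\<close> at \<open>u\<close> can be
  recoloured there in at least x = |M u| - |nb u| ways. The results are pairwise distinct and still
  avoid \<open>c\<close> on \<open>X\<close>, so at most a fraction 1/x of the colourings avoiding
  \<open>c\<close> on \<open>X\<close> use \<open>c\<close> at \<open>u\<close>.\<close>

lemma avoid_vertex:
  assumes "X \<subseteq> N" "u \<in> N" "u \<notin> X"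
  shows "real (card {\<sigma> \<in> \<Omega>. c \<notin> \<sigma> ` X}) * exp (- loss c u)
    \<le> real (card {\<sigma> \<in> \<Omega>. c \<notin> \<sigma> ` insert u X})"
proof (cases "c \<in> M u")
  case False
  then have "{\<sigma> \<in> \<Omega>. c \<notin> \<sigma> ` insert u X} = {\<sigma> \<in> \<Omega>. c \<notin> \<sigma> ` X}"
    using colour_mem[OF _ \<open>u \<in> N\<close>] by auto
  with False show ?thesis by (simp add: loss_def)
next
  case True
  define P where "P = {\<sigma> \<in> \<Omega>. c \<notin> \<sigma> ` X}"
  define Q where "Q = {\<sigma> \<in> P. \<sigma> u = c}"
  define x where "x = real (card (M u)) - real (card (nb u))"
  have x: "x \<ge> 1 + s" using card_M[OF \<open>u \<in> N\<close>] by (simp add: x_def)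
  have finP: "finite P" and finQ: "finite Q" using finite_\<Omega> by (simp_all add: P_def Q_def)
  let ?S = "SIGMA \<sigma>:Q. M u - \<sigma> ` nb u"
  have "inj_on (\<lambda>(\<sigma>, c'). \<sigma>(u := c')) ?S"
  proof (rule inj_onI, clarify)
    fix \<sigma> a \<tau> b assume "\<sigma> \<in> Q" "\<tau> \<in> Q" and eq: "\<sigma>(u := a) = \<tau>(u := b)"
    from \<open>\<sigma> \<in> Q\<close> \<open>\<tau> \<in> Q\<close> have "\<sigma> u = \<tau> u" by (simp add: Q_def)
    moreover have "\<sigma> y = \<tau> y" if "y \<noteq> u" for y using fun_cong[OF eq, of y] that by simp
    ultimately have "\<sigma> = \<tau>" by (metis ext)
    moreover have "a = b" using fun_cong[OF eq, of u] by simp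
    ultimately show "\<sigma> = \<tau> \<and> a = b" by simp
  qed
  moreover have "(\<lambda>(\<sigma>, c'). \<sigma>(u := c')) ` ?S \<subseteq> P"
  proof clarify
    fix \<sigma> c' assume "\<sigma> \<in> Q" "c' \<in> M u" "c' \<notin> \<sigma> ` nb u"
    then have "\<sigma>(u := c') \<in> \<Omega>" using recolour \<open>u \<in> N\<close> by (simp add: Q_def P_def)
    moreover have "c \<notin> (\<sigma>(u := c')) ` X" using \<open>\<sigma> \<in> Q\<close> \<open>u \<notin> X\<close> by (auto simp: Q_def P_def)
    ultimately show "\<sigma>(u := c') \<in> P" by (simp add: P_def)
  qed
  ultimately have "card ?S \<le> card P" using finP by (rule card_inj_on_le)
  moreover have "card ?S = (\<Sum>\<sigma>\<in>Q. card (M u - \<sigma> ` nb u))"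
    using finQ finite_M[OF \<open>u \<in> N\<close>] by (intro card_SigmaI) auto
  ultimately have "(\<Sum>\<sigma>\<in>Q. real (card (M u - \<sigma> ` nb u))) \<le> real (card P)"
    by (metis of_nat_le_iff of_nat_sum)
  moreover have "x \<le> real (card (M u - \<sigma> ` nb u))" for \<sigma> :: "'a \<Rightarrow> 'c"
  proof -
    have "card (M u) - card (\<sigma> ` nb u) \<le> card (M u - \<sigma> ` nb u)"
      using finite_nb[OF \<open>u \<in> N\<close>] by (intro diff_card_le_card_Diff) auto
    moreover have "card (\<sigma> ` nb u) \<le> card (nb u)"
      using finite_nb[OF \<open>u \<in> N\<close>] by (rule card_image_le)
    ultimately show ?thesis by (simp add: x_def)
  qed
  then have "(\<Sum>\<sigma>\<in>Q. x) \<le> (\<Sum>\<sigma>\<in>Q. real (card (M u - \<sigma> ` nb u)))" by (intro sum_mono) auto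
  ultimately have "real (card Q) * x \<le> real (card P)" by simp
  then have "real (card Q) \<le> real (card P) / x" using x s_pos by (simp add: field_simps)
  moreover have "{\<sigma> \<in> \<Omega>. c \<notin> \<sigma> ` insert u X} = P - Q" by (auto simp: P_def Q_def)
  moreover have "real (card (P - Q)) = real (card P) - real (card Q)"
    using finP finQ by (subst card_Diff_subset) (auto simp: Q_def of_nat_diff card_mono)
  ultimately have "real (card P) * (1 - 1 / x) \<le> real (card {\<sigma> \<in> \<Omega>. c \<notin> \<sigma> ` insert u X})"
    by (simp add: algebra_simps)
  moreover have "exp (- loss c u) \<le> 1 - 1 / x"
    using one_minus_inverse_ge_exp[of x] x s_pos True by (simp add: loss_def x_def)
  then have "real (card P) * exp (- loss c u) \<le> real (card P) * (1 - 1 / x)"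
    by (intro mult_left_mono) auto
  ultimately show ?thesis by (simp add: P_def)
qed

lemma avoid_set:
  assumes "X \<subseteq> N"
  shows "real (card \<Omega>) * exp (- (\<Sum>u\<in>X. loss c u)) \<le> real (card {\<sigma> \<in> \<Omega>. c \<notin> \<sigma> ` X})"
  using finite_subset[OF assms finite_N] assms
proof (induction X rule: finite_induct)
  case empty
  then show ?case by simp
next
  case (insert u X)
  have "real (card \<Omega>) * exp (- (\<Sum>u\<in>insert u X. loss c u))
      = real (card \<Omega>) * exp (- (\<Sum>u\<in>X. loss c u)) * exp (- loss c u)"
    using insert.hyps by (simp add: mult_exp_exp algebra_simps)
  also have "\<dots> \<le> real (card {\<sigma> \<in> \<Omega>. c \<notin> \<sigma> ` X}) * exp (- loss c u)"
    using insert by (intro mult_right_mono) auto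
  also have "\<dots> \<le> real (card {\<sigma> \<in> \<Omega>. c \<notin> \<sigma> ` insert u X})"
    using insert by (intro avoid_vertex) auto
  finally show ?case .
qed

text \<open>With y = |M u| - |nb u| - 1 \<ge> s, the vertex \<open>u\<close> costs 1/y for each of
  at most |M u| colours, and |M u| / y = 1 + (1 + |nb u|) / y.\<close>

lemma sum_loss_le:
  assumes "finite K"
  shows "(\<Sum>c\<in>K. \<Sum>u\<in>N. loss c u) \<le> (\<Sum>u\<in>N. 1 + (1 + real (card (nb u))) / s)"
proof -
  have "(\<Sum>c\<in>K. loss c u) \<le> 1 + (1 + real (card (nb u))) / s" if "u \<in> N" for u
  proof -
    define y where "y = real (card (M u)) - real (card (nb u)) - 1"
    have y: "y \<ge> s" using card_M[OF that] by (simp add: y_def)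
    have "(\<Sum>c\<in>K. loss c u) = (\<Sum>c\<in>K \<inter> M u. 1 / y)"
      unfolding sum.inter_restrict[OF assms] by (intro sum.cong) (auto simp: loss_def y_def)
    also have "\<dots> = real (card (K \<inter> M u)) / y" by simp
    also have "\<dots> \<le> real (card (M u)) / y"
      using finite_M[OF that] y s_pos by (intro divide_right_mono) (auto intro: card_mono)
    also have "\<dots> = 1 + (1 + real (card (nb u))) / y"
      using y s_pos by (simp add: y_def field_simps)
    also have "\<dots> \<le> 1 + (1 + real (card (nb u))) / s"
      using y s_pos by (intro add_left_mono divide_left_mono) auto
    finally show ?thesis .
  qed
  then show ?thesis by (subst sum.swap) (rule sum_mono)
qed

lemma unused_colours_bound:
  assumes "finite K" and a: "(\<Sum>u\<in>N. 1 + (1 + real (card (nb u))) / s) \<le> a"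
  shows "real (card \<Omega>) * (exp (- b) * (real (card K) * (1 + b) - a))
    \<le> (\<Sum>\<sigma>\<in>\<Omega>. real (card (K - \<sigma> ` N)))"
proof -
  \<comment> \<open>A tangent line of \<open>exp\<close> instead of AM-GM: the resulting bound is linear in \<open>card K\<close>, so that
    averaging over random \<open>K\<close> later needs no convexity.\<close>
  have tangent: "exp (- b) * (1 + b - z) \<le> exp (- z)" for z
  proof -
    have "exp (- b) * (1 + (b - z)) \<le> exp (- b) * exp (b - z)"
      by (intro mult_left_mono exp_ge_add_one_self) auto
    then show ?thesis by (simp add: mult_exp_exp algebra_simps)
  qed
  have "exp (- b) * (real (card K) * (1 + b) - a)
      \<le> exp (- b) * (real (card K) * (1 + b) - (\<Sum>c\<in>K. \<Sum>u\<in>N. loss c u))"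
    using sum_loss_le[OF assms(1)] a by (intro mult_left_mono) auto
  also have "\<dots> = (\<Sum>c\<in>K. exp (- b) * (1 + b - (\<Sum>u\<in>N. loss c u)))"
    by (simp add: sum_distrib_left[symmetric] sum_subtractf)
  also have "\<dots> \<le> (\<Sum>c\<in>K. exp (- (\<Sum>u\<in>N. loss c u)))" by (intro sum_mono tangent)
  finally have "real (card \<Omega>) * (exp (- b) * (real (card K) * (1 + b) - a))
      \<le> real (card \<Omega>) * (\<Sum>c\<in>K. exp (- (\<Sum>u\<in>N. loss c u)))"
    by (intro mult_left_mono) auto
  also have "\<dots> \<le> (\<Sum>c\<in>K. real (card {\<sigma> \<in> \<Omega>. c \<notin> \<sigma> ` N}))"
    unfolding sum_distrib_left by (intro sum_mono avoid_set order_refl)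
  also have "\<dots> = (\<Sum>c\<in>K. \<Sum>\<sigma>\<in>\<Omega>. if c \<notin> \<sigma> ` N then 1 else 0)"
    by (simp add: sum.inter_filter[OF finite_\<Omega>, symmetric])
  also have "\<dots> = (\<Sum>\<sigma>\<in>\<Omega>. \<Sum>c\<in>K. if c \<notin> \<sigma> ` N then 1 else 0)" by (rule sum.swap)
  also have "\<dots> = (\<Sum>\<sigma>\<in>\<Omega>. real (card (K - \<sigma> ` N)))"
    by (simp add: sum.inter_filter[OF assms(1), symmetric] set_diff_eq)
  finally show ?thesis .
qed

end

section \<open>List colourings of a finite graph\<close>

locale list_graph =
  fixes V :: "'a set" and E :: "'a \<Rightarrow> 'a \<Rightarrow> bool" and L :: "'a \<Rightarrow> nat set"
  assumes finite_V: "finite V"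
    and E_sym: "E u v \<Longrightarrow> E v u"
    and E_irrefl: "\<not> E u u"
    and finite_L: "v \<in> V \<Longrightarrow> finite (L v)"
begin

section \<open>Colourings of induced subgraphs\<close>

definition colourings :: "'a set \<Rightarrow> ('a \<Rightarrow> nat) set" where
  "colourings S = {\<sigma> \<in> \<Pi>\<^sub>E v\<in>S. L v. \<forall>u\<in>S. \<forall>v\<in>S. E u v \<longrightarrow> \<sigma> u \<noteq> \<sigma> v}"

definition nbrs :: "'a set \<Rightarrow> 'a \<Rightarrow> 'a set" where
  "nbrs S v = {u \<in> S. E v u}"

definition avail :: "'a set \<Rightarrow> ('a \<Rightarrow> nat) \<Rightarrow> 'a \<Rightarrow> nat set" where
  "avail S \<sigma> u = L u - \<sigma> ` nbrs S u"

lemma nbrs_subset: "nbrs S v \<subseteq> S"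
  by (auto simp: nbrs_def)

lemma nbrs_mono: "S \<subseteq> T \<Longrightarrow> nbrs S v \<subseteq> nbrs T v"
  by (auto simp: nbrs_def)

lemma finite_nbrs: "S \<subseteq> V \<Longrightarrow> finite (nbrs S v)"
  using finite_subset[OF nbrs_subset finite_subset[OF _ finite_V]] .

lemma finite_avail: "v \<in> V \<Longrightarrow> finite (avail S \<sigma> v)"
  by (simp add: avail_def finite_L)

lemma avail_cong: "(\<And>u. u \<in> S \<Longrightarrow> \<sigma> u = \<tau> u) \<Longrightarrow> avail S \<sigma> v = avail S \<tau> v"
  using nbrs_subset[of S v] by (auto simp: avail_def image_iff subset_iff)

lemma finite_colourings: "S \<subseteq> V \<Longrightarrow> finite (colourings S)"
  unfolding colourings_def using finite_V finite_L
  by (intro finite_subset[OF _ finite_PiE[of S L]]) (auto intro: finite_subset)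

lemma colourings_empty: "colourings {} = {\<lambda>_. undefined}"
  by (auto simp: colourings_def)

lemma colourings_insert:
  assumes "v \<notin> U"
  shows "bij_betw (\<lambda>(\<sigma>, c). \<sigma>(v := c)) (SIGMA \<sigma>:colourings U. avail U \<sigma> v)
    (colourings (insert v U))"
proof (rule bij_betwI[where g = "\<lambda>\<sigma>. (restrict \<sigma> U, \<sigma> v)"])
  show "(\<lambda>(\<sigma>, c). \<sigma>(v := c)) \<in> (SIGMA \<sigma>:colourings U. avail U \<sigma> v) \<rightarrow> colourings (insert v U)"
  proof clarify
    fix \<sigma> c assume \<sigma>: "\<sigma> \<in> colourings U" and c: "c \<in> avail U \<sigma> v"
    have "\<sigma>(v := c) \<in> (\<Pi>\<^sub>E w\<in>insert v U. L w)"
      using \<sigma> c by (intro PiE_fun_upd) (auto simp: colourings_def avail_def)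
    moreover have "(\<sigma>(v := c)) x \<noteq> (\<sigma>(v := c)) y"
      if "x \<in> insert v U" "y \<in> insert v U" "E x y" for x y
      using that \<sigma> c assms E_irrefl[of v] E_sym[of x y]
      by (auto simp: colourings_def avail_def nbrs_def)
    ultimately show "\<sigma>(v := c) \<in> colourings (insert v U)"
      unfolding colourings_def by blast
  qed
  show "(\<lambda>\<sigma>. (restrict \<sigma> U, \<sigma> v)) \<in> colourings (insert v U) \<rightarrow> (SIGMA \<sigma>:colourings U. avail U \<sigma> v)"
    by (auto simp: colourings_def avail_def nbrs_def image_iff PiE_iff)
  show "(case (restrict \<sigma> U, \<sigma> v) of (\<sigma>, c) \<Rightarrow> \<sigma>(v := c)) = \<sigma>"
    if "\<sigma> \<in> colourings (insert v U)" for \<sigma>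
  proof
    fix x
    show "(case (restrict \<sigma> U, \<sigma> v) of (\<sigma>, c) \<Rightarrow> \<sigma>(v := c)) x = \<sigma> x"
      using that by (cases "x \<in> insert v U") (auto simp: colourings_def PiE_iff extensional_def)
  qed
  show "(restrict (case x of (\<sigma>, c) \<Rightarrow> \<sigma>(v := c)) U, (case x of (\<sigma>, c) \<Rightarrow> \<sigma>(v := c)) v) = x"
    if x: "x \<in> (SIGMA \<sigma>:colourings U. avail U \<sigma> v)" for x
  proof -
    obtain \<sigma> c where [simp]: "x = (\<sigma>, c)" by (cases x)
    have "restrict (\<sigma>(v := c)) U y = \<sigma> y" for y
      using x assms by (cases "y \<in> U") (auto simp: colourings_def PiE_iff extensional_def)
    then show ?thesis by auto
  qed
qed

lemma card_colourings_insert: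
  assumes "U \<subseteq> V" "v \<in> V" "v \<notin> U"
  shows "card (colourings (insert v U)) = (\<Sum>\<sigma>\<in>colourings U. card (avail U \<sigma> v))"
proof -
  have "card (colourings (insert v U)) = card (SIGMA \<sigma>:colourings U. avail U \<sigma> v)"
    using bij_betw_same_card[OF colourings_insert[OF assms(3)]] by simp
  also have "\<dots> = (\<Sum>\<sigma>\<in>colourings U. card (avail U \<sigma> v))"
    using finite_colourings[OF assms(1)] finite_avail[OF assms(2)] by (intro card_SigmaI) auto
  finally show ?thesis .
qed

text \<open>The colours available to \<open>v\<close> depend only on the colouring of
  \<open>U\<close>. Hence every colouring counted here extends one of \<open>U\<close> that has
  fewer than \<open>t\<close> extensions to \<open>v\<close>.\<close>

lemma few_available_bound:
  assumes "U \<subseteq> V" "v \<in> V" "v \<notin> U" "t \<ge> 0"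
  shows "real (card {\<sigma> \<in> colourings (insert v U). real (card (avail U \<sigma> v)) < t})
    \<le> t * real (card (colourings U))"
proof -
  let ?B = "{\<sigma> \<in> colourings U. real (card (avail U \<sigma> v)) < t}"
  have "{\<sigma> \<in> colourings (insert v U). real (card (avail U \<sigma> v)) < t}
      \<subseteq> (\<lambda>(\<sigma>, c). \<sigma>(v := c)) ` (SIGMA \<sigma>:?B. avail U \<sigma> v)"
  proof clarify
    fix \<sigma> assume \<sigma>: "\<sigma> \<in> colourings (insert v U)" "real (card (avail U \<sigma> v)) < t"
    from \<sigma>(1) obtain \<tau> c where \<tau>: "\<tau> \<in> colourings U" "c \<in> avail U \<tau> v" "\<sigma> = \<tau>(v := c)"
      using bij_betw_imp_surj_on[OF colourings_insert[OF assms(3)]] by force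
    have "avail U \<sigma> v = avail U \<tau> v" using \<tau>(3) assms(3) by (intro avail_cong) auto
    with \<sigma>(2) \<tau> show "\<sigma> \<in> (\<lambda>(\<sigma>, c). \<sigma>(v := c)) ` (SIGMA \<sigma>:?B. avail U \<sigma> v)" by force
  qed
  moreover have fin: "finite (SIGMA \<sigma>:?B. avail U \<sigma> v)"
    using finite_colourings[OF assms(1)] finite_avail[OF assms(2)] by auto
  ultimately have "card {\<sigma> \<in> colourings (insert v U). real (card (avail U \<sigma> v)) < t}
      \<le> card (SIGMA \<sigma>:?B. avail U \<sigma> v)"
    by (rule surj_card_le[rotated])
  also have "\<dots> = (\<Sum>\<sigma>\<in>?B. card (avail U \<sigma> v))"
    using finite_colourings[OF assms(1)] finite_avail[OF assms(2)] by (intro card_SigmaI) auto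
  finally have "real (card {\<sigma> \<in> colourings (insert v U). real (card (avail U \<sigma> v)) < t})
      \<le> (\<Sum>\<sigma>\<in>?B. real (card (avail U \<sigma> v)))"
    by (simp flip: of_nat_sum)
  also have "\<dots> \<le> (\<Sum>\<sigma>\<in>?B. t)" by (intro sum_mono) auto
  also have "\<dots> = t * real (card ?B)" by simp
  also have "\<dots> \<le> t * real (card (colourings U))"
    using finite_colourings[OF assms(1)] assms(4)
    by (intro mult_left_mono) (auto intro: card_mono)
  finally show ?thesis .
qed

section \<open>Starved neighbours and the extension by one vertex\<close>

definition starved :: "'a set \<Rightarrow> 'a set \<Rightarrow> real \<Rightarrow> ('a \<Rightarrow> nat) \<Rightarrow> 'a set" where
  "starved U N s \<sigma> = {u \<in> N. real (card (avail (U - N) \<sigma> u)) < 1 + s + real (card (nbrs N u))}"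

lemma starved_cong:
  "(\<And>u. u \<in> U - N \<Longrightarrow> \<sigma> u = \<tau> u) \<Longrightarrow> starved U N s \<sigma> = starved U N s \<tau>"
  unfolding starved_def using avail_cong[of "U - N" \<sigma> \<tau>] by simp

text \<open>Fibres of \<open>\<sigma> \<mapsto> (starved U N s \<sigma>, \<sigma> off the well-supplied part of N)\<close> are closed under
  recolouring well-supplied neighbours, so \<open>unused_colours_bound\<close> applies to each of them.\<close>

lemma avail_fibre_bound:
  fixes U N s \<sigma>\<^sub>0
  defines "B \<equiv> starved U N s \<sigma>\<^sub>0"
  defines "\<Omega> \<equiv> {\<sigma> \<in> colourings U. starved U N s \<sigma> = B \<and>
    restrict \<sigma> (U - (N - B)) = restrict \<sigma>\<^sub>0 (U - (N - B))}"
  assumes U: "U \<subseteq> V" and N: "N \<subseteq> U" and v: "v \<in> V" and s: "s > 0" and b: "b \<ge> 0"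
    and a: "(\<Sum>u\<in>N. 1 + (1 + real (card (nbrs N u))) / s) \<le> a"
  shows "real (card \<Omega>) * (exp (- b) * ((real (card (L v)) - real (card B)) * (1 + b) - a))
    \<le> (\<Sum>\<sigma>\<in>\<Omega>. real (card (L v - \<sigma> ` N)))"
proof -
  let ?N = "N - B" and ?R = "U - (N - B)"
  \<comment> \<open>Starved neighbours keep their colours throughout the fibre, so these are struck
    off the list of \<open>v\<close> in advance.\<close>
  let ?K = "L v - \<sigma>\<^sub>0 ` B"
  have B: "B \<subseteq> N" by (auto simp: B_def starved_def)
  have NV: "N \<subseteq> V" using U N by blast
  have finN: "finite N" using NV finite_V by (rule finite_subset)
  have agree: "\<sigma> u = \<sigma>\<^sub>0 u" if "\<sigma> \<in> \<Omega>" "u \<in> ?R" for \<sigma> u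
  proof -
    have "restrict \<sigma> ?R u = restrict \<sigma>\<^sub>0 ?R u" using that(1) by (simp only: \<Omega>_def mem_Collect_eq)
    then show ?thesis by (simp only: restrict_apply' that(2))
  qed
  interpret recolouring \<Omega> ?N "avail ?R \<sigma>\<^sub>0" "nbrs ?N" s
  proof
    show "finite \<Omega>" using finite_colourings[OF U] by (simp add: \<Omega>_def)
    show "finite ?N" using finN by simp
    show "s > 0" by fact
    fix u assume u: "u \<in> ?N"
    then have uU: "u \<in> U" and uV: "u \<in> V" using N U by auto
    show "finite (avail ?R \<sigma>\<^sub>0 u)" using uV by (rule finite_avail)
    show "finite (nbrs ?N u)" using NV by (intro finite_nbrs) auto
    \<comment> \<open>Passing from \<open>U - N\<close> to \<open>?R\<close> removes only the
      colours fixed on \<open>B\<close>, at most |nbrs B u| of them. The threshold in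
      \<open>starved\<close> counts all neighbours in \<open>N\<close>, so it pays for these and
      still leaves |nbrs ?N u| + 1 + s.\<close>
    show "real (card (avail ?R \<sigma>\<^sub>0 u)) \<ge> real (card (nbrs ?N u)) + 1 + s"
    proof -
      have finB: "finite (nbrs B u)" using NV B by (intro finite_nbrs) auto
      have "card (avail ?R \<sigma>\<^sub>0 u) = card (avail (U - N) \<sigma>\<^sub>0 u - \<sigma>\<^sub>0 ` nbrs B u)"
        using B N by (intro arg_cong[of _ _ card]) (auto simp: avail_def nbrs_def)
      moreover have "card (avail (U - N) \<sigma>\<^sub>0 u) - card (\<sigma>\<^sub>0 ` nbrs B u)
          \<le> card (avail (U - N) \<sigma>\<^sub>0 u - \<sigma>\<^sub>0 ` nbrs B u)"
        using finB by (intro diff_card_le_card_Diff) auto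
      moreover have "card (\<sigma>\<^sub>0 ` nbrs B u) \<le> card (nbrs B u)" using finB by (rule card_image_le)
      moreover have "nbrs N u = nbrs B u \<union> nbrs ?N u" using B by (auto simp: nbrs_def)
      then have "card (nbrs N u) = card (nbrs B u) + card (nbrs ?N u)"
        using finB finite_nbrs[of ?N u] NV
        by (subst \<open>nbrs N u = _\<close>, intro card_Un_disjoint) (auto simp: nbrs_def)
      moreover have "real (card (avail (U - N) \<sigma>\<^sub>0 u)) \<ge> 1 + s + real (card (nbrs N u))"
        using u by (auto simp: B_def starved_def)
      ultimately show ?thesis by linarith
    qed
    fix \<sigma> assume \<sigma>: "\<sigma> \<in> \<Omega>"
    then have \<sigma>C: "\<sigma> \<in> colourings U" by (simp add: \<Omega>_def)
    show "\<sigma> u \<in> avail ?R \<sigma>\<^sub>0 u"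
    proof -
      have "\<sigma> u \<in> avail ?R \<sigma> u"
        using \<sigma>C uU by (auto simp: colourings_def avail_def nbrs_def PiE_iff)
      moreover have "avail ?R \<sigma> u = avail ?R \<sigma>\<^sub>0 u" using agree[OF \<sigma>] by (rule avail_cong)
      ultimately show ?thesis by simp
    qed
    fix c assume c: "c \<in> avail ?R \<sigma>\<^sub>0 u" "c \<notin> \<sigma> ` nbrs ?N u"
    have c': "c \<in> L u" "c \<notin> \<sigma> ` nbrs U u"
      using c agree[OF \<sigma>] by (auto simp: avail_def nbrs_def)
    have "\<sigma>(u := c) \<in> (\<Pi>\<^sub>E w\<in>insert u U. L w)"
      using \<sigma>C c'(1) by (intro PiE_fun_upd) (auto simp: colourings_def)
    then have "\<sigma>(u := c) \<in> (\<Pi>\<^sub>E w\<in>U. L w)" using uU by (simp add: insert_absorb)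
    moreover have "(\<sigma>(u := c)) x \<noteq> (\<sigma>(u := c)) y" if "x \<in> U" "y \<in> U" "E x y" for x y
      using that \<sigma>C c'(2) E_irrefl[of u] E_sym[of x y]
      by (auto simp: colourings_def nbrs_def)
    ultimately have "\<sigma>(u := c) \<in> colourings U" by (simp add: colourings_def)
    \<comment> \<open>Being starved is measured on \<open>U - N\<close>, which recolouring a vertex
      of \<open>N\<close> does not touch.\<close>
    moreover have "starved U N s (\<sigma>(u := c)) = starved U N s \<sigma>"
      using u by (intro starved_cong) auto
    moreover have "restrict (\<sigma>(u := c)) ?R = restrict \<sigma> ?R" using u by (auto simp: restrict_def)
    ultimately show "\<sigma>(u := c) \<in> \<Omega>" using \<sigma> by (simp add: \<Omega>_def)
  qed
  have "(\<Sum>u\<in>?N. 1 + (1 + real (card (nbrs ?N u))) / s)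
      \<le> (\<Sum>u\<in>?N. 1 + (1 + real (card (nbrs N u))) / s)"
    using s NV
    by (intro sum_mono add_left_mono divide_right_mono of_nat_mono card_mono finite_nbrs nbrs_mono
        Diff_subset) auto
  also have "\<dots> \<le> (\<Sum>u\<in>N. 1 + (1 + real (card (nbrs N u))) / s)"
    using s finN by (intro sum_mono2) auto
  also note a
  finally have "real (card \<Omega>) * (exp (- b) * (real (card ?K) * (1 + b) - a))
      \<le> (\<Sum>\<sigma>\<in>\<Omega>. real (card (?K - \<sigma> ` ?N)))"
    using finite_L[OF v] by (intro unused_colours_bound) auto
  also have "\<dots> = (\<Sum>\<sigma>\<in>\<Omega>. real (card (L v - \<sigma> ` N)))"
  proof (intro sum.cong refl arg_cong[of _ _ real] arg_cong[of _ _ card])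
    fix \<sigma> assume "\<sigma> \<in> \<Omega>"
    then have "\<sigma> ` B = \<sigma>\<^sub>0 ` B" using agree B N by (intro image_cong) auto
    moreover have "\<sigma> ` N = \<sigma> ` B \<union> \<sigma> ` ?N" using B by auto
    ultimately show "?K - \<sigma> ` ?N = L v - \<sigma> ` N" by auto
  qed
  finally have main: "real (card \<Omega>) * (exp (- b) * (real (card ?K) * (1 + b) - a))
      \<le> (\<Sum>\<sigma>\<in>\<Omega>. real (card (L v - \<sigma> ` N)))" .
  have finB: "finite B" using finN B by (rule rev_finite_subset)
  have "card (L v) - card (\<sigma>\<^sub>0 ` B) \<le> card ?K" using finB by (intro diff_card_le_card_Diff) auto
  moreover have "card (\<sigma>\<^sub>0 ` B) \<le> card B" using finB by (rule card_image_le)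
  ultimately have "real (card (L v)) - real (card B) \<le> real (card ?K)" by linarith
  then have "real (card \<Omega>) * (exp (- b) * ((real (card (L v)) - real (card B)) * (1 + b) - a))
      \<le> real (card \<Omega>) * (exp (- b) * (real (card ?K) * (1 + b) - a))"
    using b by (intro mult_left_mono diff_right_mono mult_right_mono) auto
  with main show ?thesis by linarith
qed

text \<open>The fibres partition \<open>colourings U\<close> and the starved set is constant on
  each, so the bounds of \<open>avail_fibre_bound\<close> can be summed.\<close>

lemma sum_avail_ge:
  assumes U: "U \<subseteq> V" and N: "N \<subseteq> U" and v: "v \<in> V" and s: "s > 0" and b: "b \<ge> 0"
    and a: "(\<Sum>u\<in>N. 1 + (1 + real (card (nbrs N u))) / s) \<le> a"
  shows "(\<Sum>\<sigma>\<in>colourings U.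
      exp (- b) * ((real (card (L v)) - real (card (starved U N s \<sigma>))) * (1 + b) - a))
    \<le> (\<Sum>\<sigma>\<in>colourings U. real (card (L v - \<sigma> ` N)))" (is "sum ?f _ \<le> sum ?g _")
proof -
  define r where "r \<sigma> = (starved U N s \<sigma>, restrict \<sigma> (U - (N - starved U N s \<sigma>)))" for \<sigma>
  let ?fib = "\<lambda>y. {\<sigma> \<in> colourings U. r \<sigma> = y}"
  note fin = finite_colourings[OF U]
  have "sum ?f (colourings U) = (\<Sum>y\<in>r ` colourings U. sum ?f (?fib y))"
    using fin by (intro sum.image_gen)
  also have "\<dots> \<le> (\<Sum>y\<in>r ` colourings U. sum ?g (?fib y))"
  proof (rule sum_mono)
    fix y assume "y \<in> r ` colourings U"
    then obtain \<sigma>\<^sub>0 where y: "y = r \<sigma>\<^sub>0" by blast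
    define B where "B = starved U N s \<sigma>\<^sub>0"
    have fib: "?fib y = {\<sigma> \<in> colourings U. starved U N s \<sigma> = B \<and>
        restrict \<sigma> (U - (N - B)) = restrict \<sigma>\<^sub>0 (U - (N - B))}"
      by (auto simp: y r_def B_def)
    have "sum ?f (?fib y) = real (card (?fib y)) *
        (exp (- b) * ((real (card (L v)) - real (card B)) * (1 + b) - a))"
      by (simp add: fib)
    also have "\<dots> \<le> sum ?g (?fib y)"
      unfolding fib B_def by (rule avail_fibre_bound) fact+
    finally show "sum ?f (?fib y) \<le> sum ?g (?fib y)" .
  qed
  also have "\<dots> = sum ?g (colourings U)"
    using fin by (intro sum.image_gen[symmetric])
  finally show ?thesis .
qed

text \<open>Linearity of expectation: \<open>few_available_bound\<close> on \<open>U - {u}\<close>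
  limits the colourings that starve \<open>u\<close>, and \<open>grow\<close> turns this count into
  a fraction of all colourings of \<open>U\<close>.\<close>

lemma sum_starved_le:
  assumes U: "U \<subseteq> V" and N: "N \<subseteq> U" and A: "A > 0" and s: "s > 0"
    and grow: "\<And>u. u \<in> N \<Longrightarrow> A * real (card (colourings (U - {u}))) \<le> real (card (colourings U))"
  shows "(\<Sum>\<sigma>\<in>colourings U. real (card (starved U N s \<sigma>)))
    \<le> real (card (colourings U)) * ((\<Sum>u\<in>N. 1 + s + real (card (nbrs N u))) / A)"
proof -
  have finN: "finite N" using finite_subset[OF _ finite_V] U N by blast
  let ?t = "\<lambda>u. 1 + s + real (card (nbrs N u))"
  have "(\<Sum>\<sigma>\<in>colourings U. real (card (starved U N s \<sigma>)))
      = (\<Sum>\<sigma>\<in>colourings U. \<Sum>u\<in>N. if real (card (avail (U - N) \<sigma> u)) < ?t u then 1 else 0)"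
    by (simp add: starved_def sum.inter_filter[OF finN, symmetric])
  also have "\<dots> = (\<Sum>u\<in>N. \<Sum>\<sigma>\<in>colourings U. if real (card (avail (U - N) \<sigma> u)) < ?t u then 1 else 0)"
    by (rule sum.swap)
  also have "\<dots> = (\<Sum>u\<in>N. real (card {\<sigma> \<in> colourings U. real (card (avail (U - N) \<sigma> u)) < ?t u}))"
    by (simp add: sum.inter_filter[OF finite_colourings[OF U], symmetric])
  also have "\<dots> \<le> (\<Sum>u\<in>N. ?t u * real (card (colourings U)) / A)"
  proof (rule sum_mono)
    fix u assume u: "u \<in> N"
    have uU: "insert u (U - {u}) = U" using u N by auto
    have "{\<sigma> \<in> colourings U. real (card (avail (U - N) \<sigma> u)) < ?t u}
        \<subseteq> {\<sigma> \<in> colourings (insert u (U - {u})). real (card (avail (U - {u}) \<sigma> u)) < ?t u}"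
    proof -
      \<comment> \<open>Taking more neighbours into account only removes colours, so a shortage
        measured on \<open>U - N\<close> is also one measured on \<open>U - {u}\<close>.\<close>
      have "card (avail (U - {u}) \<sigma> u) \<le> card (avail (U - N) \<sigma> u)" for \<sigma>
        using u U N by (intro card_mono finite_avail) (auto simp: avail_def nbrs_def)
      then have "real (card (avail (U - {u}) \<sigma> u)) < ?t u"
        if "real (card (avail (U - N) \<sigma> u)) < ?t u" for \<sigma>
        using that by (meson le_less_trans of_nat_mono)
      then show ?thesis unfolding uU by blast
    qed
    then have "real (card {\<sigma> \<in> colourings U. real (card (avail (U - N) \<sigma> u)) < ?t u})
        \<le> real (card {\<sigma> \<in> colourings (insert u (U - {u})). real (card (avail (U - {u}) \<sigma> u)) < ?t u})"
      unfolding uU using finite_colourings[OF U] by (intro of_nat_mono card_mono) auto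
    also have "\<dots> \<le> ?t u * real (card (colourings (U - {u})))"
      using u U N s by (intro few_available_bound) auto
    also have "\<dots> \<le> ?t u * (real (card (colourings U)) / A)"
      using grow[OF u] A s by (intro mult_left_mono) (auto simp: field_simps)
    finally show "real (card {\<sigma> \<in> colourings U. real (card (avail (U - N) \<sigma> u)) < ?t u})
        \<le> ?t u * real (card (colourings U)) / A" by simp
  qed
  also have "\<dots> = real (card (colourings U)) * ((\<Sum>u\<in>N. ?t u) / A)"
    by (simp add: sum_distrib_right[symmetric] sum_divide_distrib[symmetric])
  finally show ?thesis .
qed

lemma extension_bound:
  assumes U: "U \<subseteq> V" and v: "v \<in> V" "v \<notin> U" and A: "A > 0" and s: "s > 0" and q: "q > 0"
  defines "N \<equiv> nbrs U v"
  assumes grow: "\<And>u. u \<in> N \<Longrightarrow> A * real (card (colourings (U - {u}))) \<le> real (card (colourings U))"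
    and room: "q + (\<Sum>u\<in>N. 1 + s + real (card (nbrs N u))) / A \<le> real (card (L v))"
  shows "q * exp (- (\<Sum>u\<in>N. 1 + (1 + real (card (nbrs N u))) / s) / q) * real (card (colourings U))
    \<le> real (card (colourings (insert v U)))"
proof -
  define a where "a = (\<Sum>u\<in>N. 1 + (1 + real (card (nbrs N u))) / s)"
  \<comment> \<open>The tangent point is the mean exponent over \<open>q\<close> colours: then
    \<open>q * (1 + b) - a = q\<close>, which leaves exactly q exp(-b).\<close>
  define b where "b = a / q"
  define C where "C = real (card (colourings U))"
  have NU: "N \<subseteq> U" by (simp add: N_def nbrs_subset)
  have a0: "a \<ge> 0" using s by (auto simp: a_def intro!: sum_nonneg)
  then have b0: "b \<ge> 0" using q by (simp add: b_def)
  have ab: "a = b * q" using q by (simp add: b_def)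
  let ?B = "\<Sum>\<sigma>\<in>colourings U. real (card (starved U N s \<sigma>))"
  have "C * q \<le> C * (real (card (L v)) - (\<Sum>u\<in>N. 1 + s + real (card (nbrs N u))) / A)"
    using room by (intro mult_left_mono) (auto simp: C_def)
  also have "\<dots> \<le> C * real (card (L v)) - ?B"
    using sum_starved_le[OF U NU A s grow] by (simp add: C_def algebra_simps)
  finally have "(1 + b) * (C * q) \<le> (1 + b) * (C * real (card (L v)) - ?B)"
    using b0 by (intro mult_left_mono) auto
  then have "exp (- b) * (C * q) \<le> exp (- b) * ((C * real (card (L v)) - ?B) * (1 + b) - C * a)"
    by (intro mult_left_mono) (auto simp: ab algebra_simps)
  also have "\<dots> = (\<Sum>\<sigma>\<in>colourings U.
      exp (- b) * ((real (card (L v)) - real (card (starved U N s \<sigma>))) * (1 + b) - a))"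
    by (simp add: sum_distrib_left[symmetric] sum_distrib_right[symmetric] sum_subtractf C_def)
  also have "\<dots> \<le> (\<Sum>\<sigma>\<in>colourings U. real (card (L v - \<sigma> ` N)))"
    by (intro sum_avail_ge U NU v s b0) (simp add: a_def)
  also have "\<dots> = real (card (colourings (insert v U)))"
    using card_colourings_insert[OF U v] by (simp add: avail_def N_def)
  finally show ?thesis by (simp add: a_def b_def C_def mult_ac)
qed

end

section \<open>Sparse neighbourhoods\<close>

lemma ln2_ge_half: "ln 2 \<ge> (1 / 2 :: real)"
  using ln_le_minus_one[of "1 / 2 :: real"] by (simp add: ln_div)

text \<open>Allows values of W to be compared with l and ln deg through z exp z, and gives the
  injectivity behind W.\<close>

lemma mult_exp_le_cancel:
  fixes w z :: real
  assumes "0 \<le> w" "0 \<le> z" "w * exp w \<le> z * exp z"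
  shows "w \<le> z"
proof (rule ccontr)
  assume "\<not> w \<le> z"
  then have "z * exp z < w * exp w" using assms by (intro mult_strict_mono) auto
  with assms(3) show False by simp
qed

context list_graph
begin

text \<open>Twice the number of edges inside the neighbourhood; each triangle at \<open>v\<close>
  counts twice.\<close>

definition links :: "'a set \<Rightarrow> 'a \<Rightarrow> nat" where
  "links S v = (\<Sum>u\<in>nbrs S v. card (nbrs (nbrs S v) u))"

lemma links_mono:
  assumes "S \<subseteq> T" "T \<subseteq> V" shows "links S v \<le> links T v"
proof -
  have sub: "nbrs S v \<subseteq> nbrs T v" using assms(1) by (rule nbrs_mono)
  have fin: "finite (nbrs (nbrs T v) u)" for u
    using assms(2) by (intro finite_nbrs subset_trans[OF nbrs_subset])
  have "links S v \<le> (\<Sum>u\<in>nbrs S v. card (nbrs (nbrs T v) u))"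
    unfolding links_def by (intro sum_mono card_mono fin nbrs_mono sub)
  also have "\<dots> \<le> links T v"
    unfolding links_def using finite_nbrs[OF assms(2)] sub by (intro sum_mono2) auto
  finally show ?thesis .
qed

text \<open>A triangle on v, u, x adds the ordered pairs (v, x) and (x, v) to the count at
  \<open>u\<close>; the bound keeps the pairs that start at \<open>v\<close>.\<close>

lemma links_insert:
  assumes "insert v U \<subseteq> V" "v \<notin> U" "u \<in> nbrs U v"
  shows "links U u + card (nbrs (nbrs U v) u) \<le> links (insert v U) u"
proof -
  let ?S = "insert v U"
  have fin: "finite (nbrs (nbrs ?S u) x)" for x
    using assms(1) by (intro finite_nbrs subset_trans[OF nbrs_subset])
  have eq: "nbrs ?S u = insert v (nbrs U u)"
    using assms(3) E_sym by (auto simp: nbrs_def)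
  have "links U u \<le> (\<Sum>x\<in>nbrs U u. card (nbrs (nbrs ?S u) x))"
    unfolding links_def by (intro sum_mono card_mono fin nbrs_mono subset_insertI)
  moreover have "card (nbrs (nbrs U v) u) \<le> card (nbrs (nbrs ?S u) v)"
    by (intro card_mono fin) (auto simp: nbrs_def)
  moreover have "links ?S u = card (nbrs (nbrs ?S u) v) + (\<Sum>x\<in>nbrs U u. card (nbrs (nbrs ?S u) x))"
  proof -
    have "finite (nbrs U u)" using assms(1) by (intro finite_nbrs) auto
    moreover have "v \<notin> nbrs U u" using assms(2) by (simp add: nbrs_def)
    ultimately show ?thesis unfolding links_def by (subst (1) eq) simp
  qed
  ultimately show ?thesis by linarith
qed

end

text \<open>Here \<open>l\<close> is ln \<rho>, so \<open>deg_le\<close> is the bound by \<Delta> =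
  (d + 1) \<rho>, and \<open>links_le\<close> is the bound on the average degree of a neighbourhood.
  W enters only through its equation \<open>w_exp\<close>.\<close>

locale sparse_list_graph = list_graph +
  fixes d l :: real and w q :: "'a \<Rightarrow> real"
  assumes d_nonneg: "d \<ge> 0" and l_ge: "l \<ge> 3 / 2"
    and deg_pos: "v \<in> V \<Longrightarrow> card (nbrs V v) > 0"
    and deg_le: "v \<in> V \<Longrightarrow> real (card (nbrs V v)) \<le> (d + 1) * exp l"
    and links_le: "v \<in> V \<Longrightarrow> real (links V v) \<le> d * real (card (nbrs V v))"
    and w_nonneg: "v \<in> V \<Longrightarrow> w v \<ge> 0"
    and w_exp: "v \<in> V \<Longrightarrow> w v * exp (w v) = real (card (nbrs V v)) / ((d + 1) * l ^ 3)"
    and q_ge: "v \<in> V \<Longrightarrow> q v \<ge> (1 + 1 / l) * (real (card (nbrs V v)) / w v)"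
    and card_L_ge: "v \<in> V \<Longrightarrow> real (card (L v)) \<ge> (1 + 1 / l) * q v"
begin

section \<open>Numerical consequences of the choice of q\<close>

abbreviation deg :: "'a \<Rightarrow> real" where "deg v \<equiv> real (card (nbrs V v))"

definition s :: real where "s = (d + 1) * l"

definition A :: real where "A = (1 + 1 / l) * ((d + 1) * l ^ 3)"

text \<open>The total exponent over all colours at \<open>v\<close>, split into an edge part and a
  triangle part; \<open>cost_eq\<close> restores the form used in
  \<open>extension_bound\<close>.\<close>

definition cost :: "'a set \<Rightarrow> 'a \<Rightarrow> real" where
  "cost S v = real (card (nbrs S v)) * (1 + 1 / s) + real (links S v) / s"

lemma s_pos: "s > 0" and A_pos: "A > 0"
proof -
  have "d + 1 > 0" "l > 0" "1 + 1 / l > 0" using d_nonneg l_ge by (simp_all add: add_pos_pos)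
  then show "s > 0" "A > 0" by (simp_all add: s_def A_def)
qed

lemma cost_eq: "cost S v = (\<Sum>u\<in>nbrs S v. 1 + (1 + real (card (nbrs (nbrs S v) u))) / s)"
  by (simp add: cost_def links_def sum.distrib add_divide_distrib sum_divide_distrib algebra_simps)

lemma w_pos: "v \<in> V \<Longrightarrow> w v > 0"
proof -
  assume v: "v \<in> V"
  have "w v * exp (w v) > 0"
    unfolding w_exp[OF v] using deg_pos[OF v] d_nonneg l_ge by simp
  then show ?thesis by (simp add: zero_less_mult_iff)
qed

lemma w_le_l: assumes v: "v \<in> V" shows "w v \<le> l"
proof (rule mult_exp_le_cancel)
  have l3: "l ^ 3 \<ge> 1" using l_ge by (intro one_le_power) auto
  have "w v * exp (w v) = deg v / (d + 1) / l ^ 3" by (simp add: w_exp[OF v])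
  also have "\<dots> \<le> exp l / l ^ 3"
    using deg_le[OF v] d_nonneg l_ge by (intro divide_right_mono) (auto simp: field_simps)
  also have "\<dots> \<le> exp l" using divide_left_mono[of 1 "l ^ 3" "exp l"] l3 l_ge by simp
  also have "\<dots> \<le> l * exp l" using l_ge by simp
  finally show "w v * exp (w v) \<le> l * exp l" .
qed (use w_nonneg[OF v] l_ge in auto)

text \<open>Compare z exp z at both sides. As l^3 \<ge> 27/8 \<ge> 2, the value at
  \<open>w v\<close> is at most deg / 2; as deg \<ge> 2, the value at ln deg is deg ln deg \<ge> deg
  / 2.\<close>

lemma w_le_ln_deg: assumes v: "v \<in> V" "card (nbrs V v) \<noteq> 1" shows "w v \<le> ln (deg v)"
proof (rule mult_exp_le_cancel)
  have two: "deg v \<ge> 2" using deg_pos[OF v(1)] v(2) by linarith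
  then have "ln 2 \<le> ln (deg v)" by simp
  with ln2_ge_half have ln: "ln (deg v) \<ge> 1 / 2" by linarith
  have "(3 / 2 :: real) ^ 3 \<le> l ^ 3" using l_ge by (intro power_mono) auto
  then have l3: "l ^ 3 \<ge> 2" by (simp add: power3_eq_cube)
  also have "l ^ 3 \<le> (d + 1) * l ^ 3" using d_nonneg l_ge by (simp add: algebra_simps)
  finally have dl: "(d + 1) * l ^ 3 \<ge> 2" .
  have "w v * exp (w v) = deg v / ((d + 1) * l ^ 3)" by (rule w_exp[OF v(1)])
  also have "\<dots> \<le> deg v / 2" using dl by (intro divide_left_mono) auto
  also have "\<dots> = 1 / 2 * deg v" by simp
  also have "\<dots> \<le> ln (deg v) * deg v" using ln by (intro mult_right_mono) auto
  also have "\<dots> = ln (deg v) * exp (ln (deg v))" using two by simp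
  finally show "w v * exp (w v) \<le> ln (deg v) * exp (ln (deg v))" .
  show "0 \<le> ln (deg v)" using ln by linarith
qed (use w_nonneg[OF v(1)] in auto)

lemma q_w_ge: assumes v: "v \<in> V" shows "(1 + 1 / l) * deg v \<le> q v * w v"
  using q_ge[OF v] w_pos[OF v] by (simp add: field_simps)

lemma q_pos: assumes v: "v \<in> V" shows "q v > 0"
proof -
  have "0 < (1 + 1 / l) * (deg v / w v)"
    using deg_pos[OF v] w_pos[OF v] l_ge by (intro mult_pos_pos add_pos_pos) auto
  with q_ge[OF v] show ?thesis by linarith
qed

text \<open>The equation for \<open>w v\<close> gives deg / w = (d + 1) l^3 exp(w), so the degree
  cancels from the lower bound on q exp(-w).\<close>

lemma A_le: assumes v: "v \<in> V" shows "A \<le> q v * exp (- w v)"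
proof -
  have "(d + 1) * l ^ 3 > 0" using d_nonneg l_ge by simp
  then have "w v * exp (w v) * ((d + 1) * l ^ 3) = deg v" using w_exp[OF v] by (simp add: field_simps)
  then have "deg v / w v = (d + 1) * l ^ 3 * exp (w v)" using w_pos[OF v] by (simp add: field_simps)
  then have "(1 + 1 / l) * ((d + 1) * l ^ 3 * exp (w v)) \<le> q v" using q_ge[OF v] by simp
  then have "A * exp (w v) \<le> q v" by (simp add: A_def mult_ac)
  then have "A * exp (w v) * exp (- w v) \<le> q v * exp (- w v)" by (intro mult_right_mono) auto
  then show ?thesis by (simp add: mult.assoc mult_exp_exp)
qed

lemma card_nbrs_le: "U \<subseteq> V \<Longrightarrow> card (nbrs U v) \<le> card (nbrs V v)"
  by (intro card_mono finite_nbrs nbrs_mono order_refl)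

lemma links_sub_le: "U \<subseteq> V \<Longrightarrow> v \<in> V \<Longrightarrow> real (links U v) \<le> d * deg v"
  using links_le[of v] links_mono[of U V v] by (meson of_nat_mono order_refl order_trans)

text \<open>Sparsity bounds the cost by deg (1 + (d + 1) / s), and the choice of \<open>s\<close>
  makes the factor 1 + 1/l, the one built into \<open>q\<close>.\<close>

lemma cost_le: assumes "U \<subseteq> V" "v \<in> V" shows "cost U v \<le> q v * w v"
proof -
  have "cost U v \<le> deg v * (1 + 1 / s) + d * deg v / s"
    unfolding cost_def using card_nbrs_le[OF assms(1), of v] links_sub_le[OF assms] s_pos
    by (intro add_mono mult_right_mono divide_right_mono) auto
  also have "\<dots> = deg v * (1 + (d + 1) / s)" using s_pos by (simp add: field_simps)
  also have "(d + 1) / s = 1 / l" using d_nonneg l_ge by (simp add: s_def)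
  finally show ?thesis using q_w_ge[OF assms(2)] by (simp add: mult.commute)
qed

lemma room: assumes U: "U \<subseteq> V" and v: "v \<in> V"
  shows "q v + (\<Sum>u\<in>nbrs U v. 1 + s + real (card (nbrs (nbrs U v) u))) / A \<le> real (card (L v))"
proof -
  \<comment> \<open>The thresholds sum to at most deg (d + 1) (1 + l); dividing by \<open>A\<close>
    leaves deg / l^2. This is at most q / l, because w \<le> l forces q \<ge> deg / l.\<close>
  have A_eq: "A = (d + 1) * (1 + l) * l ^ 2"
    using l_ge by (simp add: A_def field_simps power2_eq_square power3_eq_cube)
  have "(\<Sum>u\<in>nbrs U v. 1 + s + real (card (nbrs (nbrs U v) u)))
      = real (card (nbrs U v)) * (1 + s) + real (links U v)"
    by (simp add: sum.distrib links_def algebra_simps)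
  also have "\<dots> \<le> deg v * (1 + s) + d * deg v"
    using card_nbrs_le[OF U, of v] links_sub_le[OF U v] s_pos
    by (intro add_mono mult_right_mono) auto
  also have "\<dots> = deg v * ((d + 1) * (1 + l))" by (simp add: s_def algebra_simps)
  finally have "(\<Sum>u\<in>nbrs U v. 1 + s + real (card (nbrs (nbrs U v) u))) / A
      \<le> deg v * ((d + 1) * (1 + l)) / A"
    using A_pos by (intro divide_right_mono) auto
  also have "\<dots> = deg v * ((d + 1) * (1 + l)) / ((d + 1) * (1 + l) * l ^ 2)"
    by (simp only: A_eq)
  also have "\<dots> = deg v / l / l"
    using d_nonneg l_ge by (simp add: power2_eq_square)
  also have "\<dots> \<le> q v / l"
  proof (intro divide_right_mono)
    have "deg v \<le> (1 + 1 / l) * deg v" using l_ge by (simp add: algebra_simps)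
    also have "\<dots> \<le> q v * w v" by (rule q_w_ge[OF v])
    also have "\<dots> \<le> q v * l" using w_le_l[OF v] q_pos[OF v] by (intro mult_left_mono) auto
    finally show "deg v / l \<le> q v" using l_ge by (simp add: field_simps)
  qed (use l_ge in auto)
  finally show ?thesis using card_L_ge[OF v] by (simp add: distrib_right)
qed

text \<open>The two bounds feed each other in an induction on |U|: the second one, for
  \<open>U - {u}\<close>, is the hypothesis \<open>grow\<close> that yields the first one for
  \<open>U\<close>, and the first implies the second because cost / q \<le> w and A \<le> q
  exp(-w).\<close>

lemma growth:
  assumes "U \<subseteq> V" "v \<in> V" "v \<notin> U"
  shows "q v * exp (- cost U v / q v) * real (card (colourings U)) \<le> real (card (colourings (insert v U)))
    \<and> A * real (card (colourings U)) \<le> real (card (colourings (insert v U)))"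
  using assms
proof (induction "card U" arbitrary: U v rule: less_induct)
  case less
  have grow: "A * real (card (colourings (U - {u}))) \<le> real (card (colourings U))"
    if "u \<in> nbrs U v" for u
  proof -
    have u: "u \<in> U" using that by (simp add: nbrs_def)
    then have "card (U - {u}) < card U"
      using less.prems(1) finite_V by (intro card_Diff1_less) (auto intro: finite_subset)
    from less.hyps[OF this, of u] show ?thesis
      using u less.prems(1) by (auto simp: insert_absorb)
  qed
  have 1: "q v * exp (- cost U v / q v) * real (card (colourings U)) \<le> real (card (colourings (insert v U)))"
    unfolding cost_eq
    by (rule extension_bound[OF less.prems A_pos s_pos q_pos[OF less.prems(2)] grow
          room[OF less.prems(1,2)]])
  have "cost U v / q v \<le> w v"
    using cost_le[OF less.prems(1,2)] q_pos[OF less.prems(2)] by (simp add: field_simps)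
  then have "q v * exp (- w v) \<le> q v * exp (- cost U v / q v)"
    using q_pos[OF less.prems(2)] by (intro mult_left_mono) auto
  with A_le[OF less.prems(2)] have "A \<le> q v * exp (- cost U v / q v)" by linarith
  then have "A * real (card (colourings U)) \<le> q v * exp (- cost U v / q v) * real (card (colourings U))"
    by (intro mult_right_mono) auto
  with 1 show ?case by linarith
qed

text \<open>A vertex of degree 1 gets weight 0, because \<open>w v\<close> exceeds \<open>ln (deg v) = 0\<close> there.\<close>

definition weight :: "'a \<Rightarrow> real" where
  "weight v = (if card (nbrs V v) = 1 then 0 else 1 / q v)"

lemma weight_nonneg: "v \<in> V \<Longrightarrow> weight v \<ge> 0"
  using q_pos[of v] by (simp add: weight_def)

text \<open>From q \<ge> A \<ge> l the surplus q / l of the list is at least 1, which pays for the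
  colour of the only neighbour.\<close>

lemma leaf_growth:
  assumes U: "U \<subseteq> V" and v: "v \<in> V" "v \<notin> U" and leaf: "card (nbrs V v) = 1"
  shows "q v * real (card (colourings U)) \<le> real (card (colourings (insert v U)))"
proof -
  have "A \<le> q v * exp (- w v)" by (rule A_le[OF v(1)])
  also have "\<dots> \<le> q v * 1" using q_pos[OF v(1)] w_nonneg[OF v(1)] by (intro mult_left_mono) auto
  finally have "A \<le> q v" by simp
  moreover have "l \<le> A"
  proof -
    have "1 * (1 * l) \<le> (1 + 1 / l) * ((d + 1) * l ^ 3)"
      using d_nonneg l_ge by (intro mult_mono) (auto simp: self_le_power)
    then show ?thesis by (simp add: A_def)
  qed
  ultimately have "1 \<le> q v / l" using l_ge by (simp add: field_simps)
  then have "q v + 1 \<le> real (card (L v))" using card_L_ge[OF v(1)] by (simp add: algebra_simps)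
  moreover have "real (card (L v)) - 1 \<le> real (card (avail U \<sigma> v))" for \<sigma>
  proof -
    have "card (L v) - card (\<sigma> ` nbrs U v) \<le> card (avail U \<sigma> v)"
      unfolding avail_def using finite_nbrs[OF U] by (intro diff_card_le_card_Diff) auto
    moreover have "card (\<sigma> ` nbrs U v) \<le> card (nbrs U v)" using finite_nbrs[OF U] by (rule card_image_le)
    ultimately show ?thesis using card_nbrs_le[OF U, of v] leaf by linarith
  qed
  ultimately have "q v \<le> real (card (avail U \<sigma> v))" for \<sigma> by (smt (verit))
  then have "(\<Sum>\<sigma>\<in>colourings U. q v) \<le> (\<Sum>\<sigma>\<in>colourings U. real (card (avail U \<sigma> v)))"
    by (intro sum_mono)
  then show ?thesis by (simp add: card_colourings_insert[OF U v] mult.commute)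
qed

section \<open>Adding up the exponents along a removal order\<close>

lemma weighted_growth:
  assumes "U \<subseteq> V" "v \<in> V" "v \<notin> U"
  shows "q v * exp (- weight v * cost U v) * real (card (colourings U)) \<le> real (card (colourings (insert v U)))"
proof (cases "card (nbrs V v) = 1")
  case True
  then show ?thesis using leaf_growth[OF assms True] by (simp add: weight_def)
next
  case False
  then show ?thesis using growth[OF assms] by (simp add: weight_def)
qed

text \<open>\<open>cost S v\<close> is the exponent of \<open>v\<close> if all of \<open>S\<close>
  were still present at its removal; half of the weighted total is what a good order
  achieves.\<close>

definition potential :: "'a set \<Rightarrow> real" where
  "potential S = (\<Sum>v\<in>S. weight v * cost S v) / 2"

text \<open>Each edge and triangle at \<open>v\<close> is charged at the least weight of its vertices, hence at no
  more than their average; this is what halves the exponent.\<close>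

lemma potential_insert:
  assumes V: "insert v U \<subseteq> V" and v: "v \<notin> U" and min: "\<And>u. u \<in> U \<Longrightarrow> weight v \<le> weight u"
  shows "weight v * cost U v + potential U \<le> potential (insert v U)"
proof -
  let ?S = "insert v U" and ?N = "nbrs U v"
  have U: "U \<subseteq> V" and finU: "finite U" using V finite_V by (auto intro: finite_subset)
  have nn: "weight u \<ge> 0" if "u \<in> ?S" for u using weight_nonneg that V by auto
  let ?c = "\<lambda>u. 1 + (1 + real (card (nbrs ?N u))) / s"
  \<comment> \<open>\<open>?c u\<close> is the share of \<open>u\<close> in the cost of
    \<open>v\<close>. By symmetry, joining \<open>v\<close> raises the cost of \<open>u\<close> by
    at least the same amount.\<close>
  have step: "cost U u + (if E v u then ?c u else 0) \<le> cost ?S u" if u: "u \<in> U" for u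
  proof (cases "E v u")
    case True
    have "nbrs ?S u = insert v (nbrs U u)" using True E_sym by (auto simp: nbrs_def)
    then have "card (nbrs ?S u) = Suc (card (nbrs U u))"
      using finite_nbrs[OF U, of u] v by (simp add: nbrs_def)
    moreover have "real (links U u + card (nbrs ?N u)) / s \<le> real (links ?S u) / s"
      using links_insert[OF V v, of u] True u s_pos
      by (intro divide_right_mono of_nat_mono) (auto simp: nbrs_def)
    ultimately show ?thesis using True by (simp add: cost_def algebra_simps add_divide_distrib)
  next
    case False
    have "card (nbrs U u) \<le> card (nbrs ?S u)"
      by (intro card_mono finite_nbrs V nbrs_mono subset_insertI)
    moreover have "links U u \<le> links ?S u" by (intro links_mono V subset_insertI)
    ultimately have "cost U u \<le> cost ?S u" unfolding cost_def using s_pos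
      by (intro add_mono mult_right_mono divide_right_mono) auto
    with False show ?thesis by simp
  qed
  have "nbrs ?S v = ?N" using E_irrefl by (auto simp: nbrs_def)
  then have costv: "cost ?S v = cost U v" by (simp add: cost_def links_def)
  have "weight v * cost U v = (\<Sum>u\<in>U. if E v u then weight v * ?c u else 0)"
    unfolding cost_eq sum_distrib_left
    by (simp only: sum.inter_filter[OF finU, symmetric] nbrs_def[symmetric])
  also have "\<dots> \<le> (\<Sum>u\<in>U. weight u * (if E v u then ?c u else 0))"
    using min s_pos by (intro sum_mono) (auto intro!: mult_right_mono)
  finally have "weight v * cost U v + (\<Sum>u\<in>U. weight u * cost U u)
      \<le> (\<Sum>u\<in>U. weight u * (cost U u + (if E v u then ?c u else 0)))"
    by (simp add: distrib_left sum.distrib)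
  also have "\<dots> \<le> (\<Sum>u\<in>U. weight u * cost ?S u)"
    by (intro sum_mono mult_left_mono step nn) auto
  finally show ?thesis using finU v by (simp add: potential_def costv)
qed

lemma card_colourings_ge:
  assumes "S \<subseteq> V"
  shows "(\<Prod>v\<in>S. q v) * exp (- potential S) \<le> real (card (colourings S))"
  using assms
proof (induction "card S" arbitrary: S)
  case 0
  then have "S = {}" using finite_V by (auto dest: finite_subset)
  then show ?case by (simp add: colourings_empty potential_def)
next
  case (Suc n)
  have fin: "finite S" using Suc.prems finite_V by (rule finite_subset)
  have "S \<noteq> {}" using Suc.hyps(2) by auto
  \<comment> \<open>Least weight is what \<open>potential_insert\<close> asks of the removed
    vertex.\<close>
  then obtain v where v: "v \<in> S" "\<And>u. u \<in> S \<Longrightarrow> weight v \<le> weight u"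
    using fin by (metis arg_min_if_finite(1) arg_min_least)
  define U where "U = S - {v}"
  have S: "S = insert v U" "v \<notin> U" using v by (auto simp: U_def)
  have U: "U \<subseteq> V" and vV: "v \<in> V" and finU: "finite U" using Suc.prems S fin by auto
  have IH: "(\<Prod>u\<in>U. q u) * exp (- potential U) \<le> real (card (colourings U))"
    using Suc.hyps(2) S finU by (intro Suc.hyps(1) U) auto
  have "potential U + weight v * cost U v \<le> potential S"
    using potential_insert[of v U] S v Suc.prems by (simp add: add.commute)
  then have "exp (- potential S) \<le> exp (- (potential U + weight v * cost U v))" by simp
  also have "\<dots> = exp (- potential U) * exp (- weight v * cost U v)"
    by (simp add: mult_exp_exp)
  finally have "(\<Prod>u\<in>S. q u) * exp (- potential S)
      \<le> (\<Prod>u\<in>S. q u) * (exp (- potential U) * exp (- weight v * cost U v))"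
    using q_pos Suc.prems by (intro mult_left_mono prod_nonneg) (auto intro: less_imp_le)
  also have "\<dots> = q v * exp (- weight v * cost U v) * ((\<Prod>u\<in>U. q u) * exp (- potential U))"
    using S finU by simp
  also have "\<dots> \<le> q v * exp (- weight v * cost U v) * real (card (colourings U))"
    using IH q_pos[OF vV] by (intro mult_left_mono) auto
  also have "\<dots> \<le> real (card (colourings S))"
    unfolding S(1) using U vV S(2) by (rule weighted_growth)
  finally show ?case .
qed

lemma card_colourings_ge_prod:
  "(\<Prod>v\<in>V. q v / sqrt (deg v)) \<le> real (card (colourings V))"
proof -
  \<comment> \<open>At a leaf both sides are 0; elsewhere cost / q \<le> w \<le> ln deg.\<close>
  have "weight v * cost V v \<le> ln (deg v)" if v: "v \<in> V" for v
  proof (cases "card (nbrs V v) = 1")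
    case False
    have "cost V v / q v \<le> w v"
      using cost_le[OF order_refl v] q_pos[OF v] by (simp add: field_simps)
    also have "\<dots> \<le> ln (deg v)" using v False by (rule w_le_ln_deg)
    finally show ?thesis using False by (simp add: weight_def)
  qed (simp add: weight_def)
  then have "potential V \<le> (\<Sum>v\<in>V. ln (deg v) / 2)"
    unfolding potential_def sum_divide_distrib[symmetric] by (intro divide_right_mono sum_mono) auto
  moreover have "(\<Prod>v\<in>V. q v / sqrt (deg v)) = (\<Prod>v\<in>V. q v) * exp (- (\<Sum>v\<in>V. ln (deg v) / 2))"
  proof -
    have "exp (- (ln (deg v) / 2)) = 1 / sqrt (deg v)" if "v \<in> V" for v
    proof -
      have "deg v > 0" using deg_pos[OF that] by simp
      then have "exp (ln (deg v) / 2) = sqrt (deg v)" by (simp flip: ln_sqrt)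
      then show ?thesis by (simp add: exp_minus inverse_eq_divide)
    qed
    then show ?thesis
      by (simp add: sum_negf[symmetric] exp_sum finite_V prod.distrib[symmetric])
  qed
  moreover have "(\<Prod>v\<in>V. q v) \<ge> 0" using q_pos by (intro prod_nonneg) (auto intro: less_imp_le)
  ultimately have "(\<Prod>v\<in>V. q v / sqrt (deg v)) \<le> (\<Prod>v\<in>V. q v) * exp (- potential V)"
    by (auto intro!: mult_left_mono)
  with card_colourings_ge[OF order_refl] show ?thesis by linarith
qed

end

section \<open>Geometric means and the Lambert function\<close>

text \<open>Source of the constant 3/2 in \<open>l_ge\<close>: \<rho> \<ge> 6 together with e \<le>
  3 and ln 2 \<ge> 1/2.\<close>

lemma ln6_ge: "ln 6 \<ge> (3 / 2 :: real)"
proof -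
  have "ln (exp 1) \<le> ln (3 :: real)" using exp_le by (subst ln_le_cancel_iff) auto
  then have "1 \<le> ln (3 :: real)" by simp
  moreover have "ln (6 :: real) = ln 2 + ln 3" using ln_mult[of 2 "3 :: real"] by simp
  ultimately show ?thesis using ln2_ge_half by linarith
qed

text \<open>The function z exp z is 0 at 0 and at least x at z = x, so the intermediate value
  theorem puts x in its range, where the inverse is meaningful.\<close>

lemma lambert_W:
  assumes "x \<ge> 0"
  shows lambert_W_nonneg: "lambert_W x \<ge> 0"
    and lambert_W_mult_exp: "lambert_W x * exp (lambert_W x) = x"
proof -
  have inj: "inj_on (\<lambda>z::real. z * exp z) {0..}"
    by (intro inj_onI antisym) (auto intro: mult_exp_le_cancel)
  have "x * 1 \<le> x * exp x" using assms by (intro mult_left_mono) auto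
  then have "\<exists>z. 0 \<le> z \<and> z \<le> x \<and> z * exp z = x"
    using assms by (intro IVT') (auto intro!: continuous_intros)
  then have x: "x \<in> (\<lambda>z. z * exp z) ` {0..}" by force
  show "lambert_W x \<ge> 0"
    using the_inv_into_into[OF inj x order_refl] by (simp add: lambert_W_def)
  show "lambert_W x * exp (lambert_W x) = x"
    using f_the_inv_into_f[OF inj x] by (simp add: lambert_W_def)
qed

lemma geometric_mean_power:
  assumes "finite A" "A \<noteq> {}" "\<And>x. x \<in> A \<Longrightarrow> f x \<ge> 0"
  shows "geometric_mean A f ^ card A = prod f A"
  using assms by (simp add: geometric_mean_def card_gt_0_iff prod_nonneg real_root_pow_pos2)

lemma sqrt_prod: "sqrt (prod f A) = (\<Prod>x\<in>A. sqrt (f x))"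
  by (induction A rule: infinite_finite_induct) (simp_all add: real_sqrt_mult)

lemma geometric_mean_quotient_power:
  assumes "finite A" "A \<noteq> {}" "\<And>x. x \<in> A \<Longrightarrow> f x \<ge> 0" "\<And>x. x \<in> A \<Longrightarrow> g x \<ge> 0"
  shows "(geometric_mean A f / sqrt (geometric_mean A g)) ^ card A = (\<Prod>x\<in>A. f x / sqrt (g x))"
  using geometric_mean_power[OF assms(1,2), of f] geometric_mean_power[OF assms(1,2), of g] assms(3,4)
  by (simp add: power_divide real_sqrt_power[symmetric] sqrt_prod prod_dividef)

section \<open>Reduction to finite lists, and degrees as neighbourhood sizes\<close>

lemma card_at_least_mono: "card_at_least A x \<Longrightarrow> A \<subseteq> B \<Longrightarrow> card_at_least B x"
  unfolding card_at_least_def by (meson card_mono finite_subset of_nat_mono order_trans)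

lemma card_at_least_finite_subset:
  assumes "card_at_least A x"
  obtains B where "B \<subseteq> A" "finite B" "x \<le> real (card B)"
proof (cases "finite A")
  case True
  with assms that show ?thesis by (auto simp: card_at_least_def)
next
  case False
  then obtain B where "finite B" "card B = nat \<lceil>x\<rceil>" "B \<subseteq> A" by (meson infinite_arbitrarily_large)
  with that[of B] show ?thesis by (simp add: real_nat_ceiling_ge)
qed

lemma (in nomulti_digraph) inj_on_head_out_arcs: "inj_on (head G) (out_arcs G v)"
  by (intro inj_onI no_multi_arcs) (auto simp: arc_to_ends_def)

lemma (in nomulti_digraph) out_degree_eq_card_neighbourhood:
  "out_degree G v = card (neighbourhood G v)"
proof -
  have "head G ` out_arcs G v = neighbourhood G v"
    by (auto simp: neighbourhood_def arcs_ends_conv)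
  then show ?thesis using card_image[OF inj_on_head_out_arcs] by (metis out_degree_def)
qed

lemma (in nomulti_digraph) out_degree_induce_subgraph:
  assumes "v \<in> S"
  shows "out_degree (G \<restriction> S) v = card {u \<in> S. v \<rightarrow> u}"
proof -
  have "head G ` out_arcs (G \<restriction> S) v = {u \<in> S. v \<rightarrow> u}"
    using assms by (auto simp: out_arcs_def arcs_ends_conv)
  moreover have "out_arcs (G \<restriction> S) v \<subseteq> out_arcs G v" by (auto simp: out_arcs_def)
  ultimately show ?thesis
    using card_image[OF inj_on_subset[OF inj_on_head_out_arcs]] by (metis out_degree_def)
qed

theorem theorem3:
  fixes G :: "('a, 'b) pre_digraph"
    and n \<Delta> :: nat
    and d \<rho> :: real
    and q :: "'a \<Rightarrow> real"
    and L :: "'a \<Rightarrow> nat set"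
  assumes "Digraph.graph G"
    and "n = card (verts G)"
    and "\<Delta> = max_degree G"
    and "\<And>u. u \<in> verts G \<Longrightarrow> average_degree (G \<restriction> neighbourhood G u) \<le> d"
    and "d \<le> real \<Delta> / 6 - 1"
    and "\<rho> = real \<Delta> / (d + 1)"
    and "\<And>v. v \<in> verts G \<Longrightarrow>
           q v \<ge> (1 + 1 / ln \<rho>) *
             (real (out_degree G v) /
               lambert_W (real (out_degree G v) / ((d + 1) * (ln \<rho>) ^ 3)))"
    and "\<And>v. v \<in> verts G \<Longrightarrow> card_at_least (L v) ((1 + 1 / ln \<rho>) * q v)"
  shows "card_at_least (proper_list_colourings G L)
           ((geometric_mean (verts G) q
              / sqrt (geometric_mean (verts G) (\<lambda>v. real (out_degree G v)))) ^ n)"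
proof -
  interpret graph G by fact
  let ?V = "verts G" and ?l = "ln \<rho>"
  let ?deg = "\<lambda>v. real (out_degree G v)"
  let ?x = "(geometric_mean ?V q / sqrt (geometric_mean ?V ?deg)) ^ n"
  consider "?V = {}" | v where "v \<in> ?V" "out_degree G v = 0"
    | "?V \<noteq> {}" "\<And>v. v \<in> ?V \<Longrightarrow> out_degree G v > 0"
    by blast
  then show ?thesis
  proof cases
    case 1
    \<comment> \<open>Here n = 0, so the bound is a zeroth power, 1, met by the empty
      colouring.\<close>
    then have "proper_list_colourings G L = {\<lambda>_. undefined}"
      by (auto simp: proper_list_colourings_def dest: adj_in_verts)
    with 1 assms(2) show ?thesis by (simp add: card_at_least_def)
  next
    case 2
    \<comment> \<open>An isolated vertex makes D = 0; since division by 0 gives 0, the bound is 0^n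
      = 0 with n > 0.\<close>
    then have "prod ?deg ?V = 0" by (intro prod_zero) auto
    then have "geometric_mean ?V ?deg = 0" by (simp only: geometric_mean_def real_root_zero)
    moreover have "n > 0" using 2(1) by (auto simp: assms(2) card_gt_0_iff)
    ultimately show ?thesis by (simp add: card_at_least_def zero_power)
  next
    case 3
    \<comment> \<open>Lists are cut down to finite sublists of the required size; a colouring from
      these is also one from \<open>L\<close>.\<close>
    have "\<forall>v\<in>?V. \<exists>B. B \<subseteq> L v \<and> finite B \<and> (1 + 1 / ?l) * q v \<le> real (card B)"
      using assms(8) by (meson card_at_least_finite_subset)
    then obtain L' where L': "\<And>v. v \<in> ?V \<Longrightarrow> L' v \<subseteq> L v" "\<And>v. v \<in> ?V \<Longrightarrow> finite (L' v)"
        "\<And>v. v \<in> ?V \<Longrightarrow> (1 + 1 / ?l) * q v \<le> real (card (L' v))"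
      by metis
    interpret list_graph ?V "\<lambda>u v. u \<rightarrow>\<^bsub>G\<^esub> v" L'
      using L'(2) by unfold_locales (auto intro: arcs_ends_symmetric[OF sym_arcs] dest: adj_not_same)
    have nbrs: "nbrs ?V v = neighbourhood G v" for v
      by (auto simp: nbrs_def neighbourhood_def dest: adj_in_verts)
    have deg: "card (nbrs ?V v) = out_degree G v" for v
      by (simp add: nbrs out_degree_eq_card_neighbourhood)
    have avg: "average_degree (G \<restriction> neighbourhood G v) = real (links ?V v) / ?deg v" for v
      by (simp add: average_degree_def links_def nbrs out_degree_eq_card_neighbourhood
          out_degree_induce_subgraph) (simp add: nbrs_def)
    obtain v\<^sub>0 where v0: "v\<^sub>0 \<in> ?V" using 3 by blast
    have "0 \<le> average_degree (G \<restriction> neighbourhood G v\<^sub>0)" by (simp add: avg)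
    also have "\<dots> \<le> d" by (rule assms(4)[OF v0])
    finally have d: "d \<ge> 0" .
    \<comment> \<open>As d bounds an average degree, d + 1 is positive, and d \<le> \<Delta>/6 - 1
      rearranges to \<rho> \<ge> 6.\<close>
    then have \<rho>: "\<rho> \<ge> 6" using assms(5) by (simp add: assms(6) field_simps)
    have l: "?l \<ge> 3 / 2"
    proof -
      have "ln 6 \<le> ?l" using \<rho> by simp
      with ln6_ge show ?thesis by linarith
    qed
    have arg: "?deg v / ((d + 1) * ?l ^ 3) \<ge> 0" for v using d l by simp
    interpret sparse_list_graph ?V "\<lambda>u v. u \<rightarrow>\<^bsub>G\<^esub> v" L' d ?l
      "\<lambda>v. lambert_W (?deg v / ((d + 1) * ?l ^ 3))" q
    proof
      show "d \<ge> 0" "?l \<ge> 3 / 2" by fact+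
      fix v assume v: "v \<in> ?V"
      show "card (nbrs ?V v) > 0" using 3(2)[OF v] by (simp add: deg)
      show "real (links ?V v) \<le> d * real (card (nbrs ?V v))"
        using assms(4)[OF v] 3(2)[OF v] by (simp add: avg deg field_simps)
      have "out_degree G v \<le> \<Delta>" using v by (simp add: assms(3) max_degree_def)
      moreover have "(d + 1) * exp ?l = real \<Delta>" using \<rho> d by (simp add: assms(6))
      ultimately show "real (card (nbrs ?V v)) \<le> (d + 1) * exp ?l" by (simp add: deg)
      show "lambert_W (?deg v / ((d + 1) * ?l ^ 3)) \<ge> 0" using arg by (rule lambert_W_nonneg)
      show "lambert_W (?deg v / ((d + 1) * ?l ^ 3)) * exp (lambert_W (?deg v / ((d + 1) * ?l ^ 3)))
          = real (card (nbrs ?V v)) / ((d + 1) * ?l ^ 3)"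
        unfolding deg using arg by (rule lambert_W_mult_exp)
      show "q v \<ge> (1 + 1 / ?l) * (real (card (nbrs ?V v)) / lambert_W (?deg v / ((d + 1) * ?l ^ 3)))"
        unfolding deg using v by (rule assms(7))
      show "real (card (L' v)) \<ge> (1 + 1 / ?l) * q v" using v by (rule L'(3))
    qed
    have "?x = (\<Prod>v\<in>?V. q v / sqrt (?deg v))"
      unfolding assms(2) using 3(1) q_pos by (intro geometric_mean_quotient_power) (auto intro: less_imp_le)
    then have "?x \<le> real (card (colourings ?V))" using card_colourings_ge_prod by (simp add: deg)
    then have "card_at_least (colourings ?V) ?x" by (simp add: card_at_least_def)
    moreover have "colourings ?V \<subseteq> proper_list_colourings G L"
    proof
      fix \<sigma> assume \<sigma>: "\<sigma> \<in> colourings ?V"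
      have "\<sigma> \<in> (\<Pi>\<^sub>E v\<in>?V. L v)" using \<sigma> L'(1) by (auto simp: colourings_def PiE_iff)
      moreover have "\<sigma> u \<noteq> \<sigma> v" if "u \<rightarrow>\<^bsub>G\<^esub> v" for u v
        using \<sigma> that adj_in_verts[OF that] by (simp add: colourings_def)
      ultimately show "\<sigma> \<in> proper_list_colourings G L" by (simp add: proper_list_colourings_def)
    qed
    ultimately show ?thesis by (rule card_at_least_mono)
  qed
qed

end
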